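(* Let $\mathcal{Q}$ be a quaternion division algebra over a field. Let $V$ be a right $\mathcal{Q}$-vector space with finite dimension, and let $u$ be a $\mathcal{Q}$-linear endomorphism of $V$. Then the following conditions are equivalent: (i) $u$ is represented, in some basis of $V$, by a matrix with all diagonal entries zero; (ii) $u$ is the sum of two nilpotent endomorphisms of $V$.
   Context: The base field $\mathbb{F}$ is arbitrary (characteristic $2$ allowed). A quaternion division algebra over $\mathbb{F}$ is a $4$-dimensional associative unital $\mathbb{F}$-algebra with center $\mathbb{F}$ that is a division ring. The matrix $(m_{i,j})$ of $u$ in a basis $(e_1,\dots,e_n)$ is given by $u(e_j)=\sum_i e_i m_{i,j}$. *)

theory Defs
  imports Complex_Main
begin

text \<open>
  The modules and vector spaces of the library have commutative scalars, so right vector spaces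
  over a division ring and their linear maps are introduced here.  The underlying field
  is the type \<open>'f\<close>, the quaternion division algebra is the type \<open>'q\<close>, and the right
  vector space is the type \<open>'v\<close>.
\<close>

locale quaternion_division_algebra = vector_space scale
  for scale :: "'f::field \<Rightarrow> 'q::division_ring \<Rightarrow> 'q"  (infixr \<open>*\<^sub>F\<close> 75) +
  assumes scale_mult_left: "(a *\<^sub>F x) * y = a *\<^sub>F (x * y)"
    and scale_mult_right: "x * (a *\<^sub>F y) = a *\<^sub>F (x * y)"
    \<comment> \<open>\<open>dim\<close> is \<open>0\<close> for infinite-dimensional spaces, so this includes finite-dimensionality\<close>
    and dim_eq_4: "dim UNIV = 4"
    and center_eq: "{z. \<forall>x. z * x = x * z} = range (\<lambda>a. a *\<^sub>F 1)"

locale right_vector_space =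
  fixes rscale :: "'v::ab_group_add \<Rightarrow> 'q::division_ring \<Rightarrow> 'v"  (infixl \<open>*\<^sub>Q\<close> 75)
  assumes rscale_add_left: "(x + y) *\<^sub>Q p = x *\<^sub>Q p + y *\<^sub>Q p"
    and rscale_add_right: "x *\<^sub>Q (p + q) = x *\<^sub>Q p + x *\<^sub>Q q"
    and rscale_rscale: "(x *\<^sub>Q p) *\<^sub>Q q = x *\<^sub>Q (p * q)"
    and rscale_one: "x *\<^sub>Q 1 = x"
begin

text \<open>
  Ordered families are functions on \<open>nat\<close> of which only the values at indices \<open>i < n\<close> matter;
  likewise for the entries of an \<open>n \<times> n\<close> matrix.  The case \<open>n = 0\<close> is allowed.
\<close>

definition independent_family :: "nat \<Rightarrow> (nat \<Rightarrow> 'v) \<Rightarrow> bool" where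
  "independent_family n e \<longleftrightarrow>
     (\<forall>c :: nat \<Rightarrow> 'q. (\<Sum>i<n. e i *\<^sub>Q c i) = 0 \<longrightarrow> (\<forall>i<n. c i = 0))"

definition spanning_family :: "nat \<Rightarrow> (nat \<Rightarrow> 'v) \<Rightarrow> bool" where
  "spanning_family n e \<longleftrightarrow> (\<forall>v. \<exists>c :: nat \<Rightarrow> 'q. v = (\<Sum>i<n. e i *\<^sub>Q c i))"

definition ordered_basis :: "nat \<Rightarrow> (nat \<Rightarrow> 'v) \<Rightarrow> bool" where
  "ordered_basis n e \<longleftrightarrow> independent_family n e \<and> spanning_family n e"

definition finite_dim :: bool where
  "finite_dim \<longleftrightarrow> (\<exists>n e. ordered_basis n e)"

definition endomorphism :: "('v \<Rightarrow> 'v) \<Rightarrow> bool" where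
  "endomorphism f \<longleftrightarrow> (\<forall>x y. f (x + y) = f x + f y) \<and> (\<forall>x q. f (x *\<^sub>Q q) = f x *\<^sub>Q q)"

definition has_matrix :: "nat \<Rightarrow> (nat \<Rightarrow> 'v) \<Rightarrow> ('v \<Rightarrow> 'v) \<Rightarrow> (nat \<Rightarrow> nat \<Rightarrow> 'q) \<Rightarrow> bool" where
  "has_matrix n e f m \<longleftrightarrow> (\<forall>j<n. f (e j) = (\<Sum>i<n. e i *\<^sub>Q m i j))"

definition nilpotent_endomorphism :: "('v \<Rightarrow> 'v) \<Rightarrow> bool" where
  "nilpotent_endomorphism f \<longleftrightarrow> endomorphism f \<and> (\<exists>k. f ^^ k = (\<lambda>_. 0))"

end

end

(* (i) => (ii): split the matrix into its strictly upper and strictly lower triangular parts.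

   (ii) => (i): if u = a + b with a, b nilpotent, then the kernels of the powers of a and those of
   the powers of b form two filtrations of V, and two filtrations always admit a common adapted
   basis, in the spirit of the Bruhat decomposition.  For a vector e of such a basis, a e lies in
   an earlier stage of the first filtration than e, hence in the span of the other basis vectors,
   and likewise for b e, so the diagonal entry at e vanishes.

   To obtain the adapted basis, let k x and l x be the first stages of the two filtrations that
   contain x, well-order V lexicographically by k, l and an arbitrary well-order, and keep the
   vectors that are not combinations of their predecessors. *)

theory Submission
  imports Defs
begin

context right_vector_space
begin

section \<open>Arithmetic of the right action\<close>

lemma rscale_zero_left [simp]: "0 *\<^sub>Q q = 0"
  using rscale_add_left[of 0 0 q] by simp

lemma rscale_zero_right [simp]: "x *\<^sub>Q 0 = 0"
  using rscale_add_right[of x 0 0] by simp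

lemma rscale_minus_right: "x *\<^sub>Q (- q) = - (x *\<^sub>Q q)"
  using rscale_add_right[of x q "- q"] by (simp add: eq_neg_iff_add_eq_0 add.commute)

lemma rscale_diff_right: "x *\<^sub>Q (p - q) = x *\<^sub>Q p - x *\<^sub>Q q"
  using rscale_add_right[of x p "- q"] by (simp add: rscale_minus_right)

lemma rscale_sum_left: "sum f A *\<^sub>Q q = (\<Sum>i\<in>A. f i *\<^sub>Q q)"
  by (induction A rule: infinite_finite_induct) (simp_all add: rscale_add_left)

lemma rscale_sum_right: "x *\<^sub>Q sum c A = (\<Sum>i\<in>A. x *\<^sub>Q c i)"
  by (induction A rule: infinite_finite_induct) (simp_all add: rscale_add_right)

section \<open>Subspaces and spans\<close>

definition subspace :: "'v set \<Rightarrow> bool" where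
  "subspace S \<longleftrightarrow> 0 \<in> S \<and> (\<forall>x\<in>S. \<forall>y\<in>S. x + y \<in> S) \<and> (\<forall>x\<in>S. \<forall>q. x *\<^sub>Q q \<in> S)"

lemma subspace_0: "subspace S \<Longrightarrow> 0 \<in> S"
  and subspace_add: "subspace S \<Longrightarrow> x \<in> S \<Longrightarrow> y \<in> S \<Longrightarrow> x + y \<in> S"
  and subspace_rscale: "subspace S \<Longrightarrow> x \<in> S \<Longrightarrow> x *\<^sub>Q q \<in> S"
  by (auto simp: subspace_def)

lemma subspace_diff: "subspace S \<Longrightarrow> x \<in> S \<Longrightarrow> y \<in> S \<Longrightarrow> x - y \<in> S"
  using subspace_add[of S x "y *\<^sub>Q (- 1)"] subspace_rscale[of S y "- 1"]
  by (simp add: rscale_minus_right rscale_one)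

lemma subspace_sum: "subspace S \<Longrightarrow> (\<And>i. i \<in> A \<Longrightarrow> f i \<in> S) \<Longrightarrow> sum f A \<in> S"
  by (induction A rule: infinite_finite_induct) (auto intro: subspace_0 subspace_add)

definition span :: "'v set \<Rightarrow> 'v set" where
  "span S = subspace hull S"

lemma subspace_span: "subspace (span S)"
  unfolding span_def by (rule hull_in) (auto simp: subspace_def)

lemma span_base: "x \<in> S \<Longrightarrow> x \<in> span S"
  unfolding span_def by (rule hull_inc)

lemma span_minimal: "S \<subseteq> T \<Longrightarrow> subspace T \<Longrightarrow> span S \<subseteq> T"
  unfolding span_def by (rule hull_minimal)

lemma span_mono: "S \<subseteq> T \<Longrightarrow> span S \<subseteq> span T"
  unfolding span_def by (rule hull_mono)

lemma span_empty: "span {} = {0}"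
proof -
  have "subspace {0}" by (simp add: subspace_def)
  then show ?thesis using span_minimal[of "{}" "{0}"] subspace_0[OF subspace_span] by blast
qed

lemma span_image_finite:
  assumes "finite I" and "x \<in> span (e ` I)"
  shows "\<exists>c. x = (\<Sum>i\<in>I. e i *\<^sub>Q c i)"
proof -
  let ?T = "{x. \<exists>c. x = (\<Sum>i\<in>I. e i *\<^sub>Q c i)}"
  have "subspace ?T"
    unfolding subspace_def
  proof (intro conjI ballI allI)
    show "0 \<in> ?T" by (intro CollectI exI[of _ "\<lambda>_. 0"]) simp
  next
    fix x y assume "x \<in> ?T" "y \<in> ?T"
    then obtain c d where "x = (\<Sum>i\<in>I. e i *\<^sub>Q c i)" "y = (\<Sum>i\<in>I. e i *\<^sub>Q d i)" by blast
    then show "x + y \<in> ?T"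
      by (intro CollectI exI[of _ "\<lambda>i. c i + d i"]) (simp add: rscale_add_right sum.distrib)
  next
    fix x q assume "x \<in> ?T"
    then obtain c where "x = (\<Sum>i\<in>I. e i *\<^sub>Q c i)" by blast
    then show "x *\<^sub>Q q \<in> ?T"
      by (intro CollectI exI[of _ "\<lambda>i. c i * q"]) (simp add: rscale_sum_left rscale_rscale)
  qed
  moreover have "e ` I \<subseteq> ?T"
  proof clarify
    fix i assume "i \<in> I"
    then have "(\<Sum>j\<in>I. e j *\<^sub>Q (if j = i then 1 else 0)) = e i"
      using \<open>finite I\<close>
      by (subst sum.remove[of _ i]) (auto simp: rscale_one intro!: sum.neutral)
    then show "\<exists>c. e i = (\<Sum>j\<in>I. e j *\<^sub>Q c j)" by metis
  qed
  ultimately show ?thesis using span_minimal[of "e ` I" ?T] assms(2) by blast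
qed

text \<open>Serves to split a combination of predecessors into a part of smaller \<open>k\<close>
  and a part of bounded \<open>l\<close>.\<close>

lemma span_Un:
  assumes "x \<in> span (S \<union> T)"
  shows "\<exists>w\<in>span S. \<exists>z\<in>span T. x = w + z"
proof -
  let ?U = "{x. \<exists>w\<in>span S. \<exists>z\<in>span T. x = w + z}"
  have "subspace ?U"
    unfolding subspace_def
  proof (intro conjI ballI allI)
    show "0 \<in> ?U" using subspace_0[OF subspace_span] by force
  next
    fix x y assume "x \<in> ?U" "y \<in> ?U"
    then obtain w z w' z' where *: "w \<in> span S" "z \<in> span T" "x = w + z"
      "w' \<in> span S" "z' \<in> span T" "y = w' + z'" by blast
    have "x + y = (w + w') + (z + z')" using * by simp
    with * show "x + y \<in> ?U" using subspace_add[OF subspace_span] by blast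
  next
    fix x q assume "x \<in> ?U"
    then show "x *\<^sub>Q q \<in> ?U" using subspace_rscale[OF subspace_span] rscale_add_left by blast
  qed
  moreover have "S \<union> T \<subseteq> ?U"
  proof
    fix x assume "x \<in> S \<union> T"
    then have "x \<in> span S \<and> 0 \<in> span T \<and> x = x + 0 \<or> 0 \<in> span S \<and> x \<in> span T \<and> x = 0 + x"
      using subspace_0[OF subspace_span] span_base by auto
    then show "x \<in> ?U" by blast
  qed
  ultimately show ?thesis using span_minimal[of "S \<union> T" ?U] assms by blast
qed

text \<open>Ensures that finitely many kept vectors suffice to express a finite spanning
  family.\<close>

lemma span_finite_subset:
  assumes "x \<in> span S"
  shows "\<exists>T. finite T \<and> T \<subseteq> S \<and> x \<in> span T"
proof -
  let ?U = "{x. \<exists>T. finite T \<and> T \<subseteq> S \<and> x \<in> span T}"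
  have "subspace ?U"
    unfolding subspace_def
  proof (intro conjI ballI allI)
    show "0 \<in> ?U" using subspace_0[OF subspace_span] by blast
  next
    fix x y assume "x \<in> ?U" "y \<in> ?U"
    then obtain T T' where *: "finite T" "T \<subseteq> S" "x \<in> span T"
      "finite T'" "T' \<subseteq> S" "y \<in> span T'" by blast
    have "x + y \<in> span (T \<union> T')"
      using * span_mono[of T "T \<union> T'"] span_mono[of T' "T \<union> T'"]
      by (intro subspace_add subspace_span) auto
    with * show "x + y \<in> ?U" by (intro CollectI exI[of _ "T \<union> T'"]) simp
  next
    fix x q assume "x \<in> ?U"
    then show "x *\<^sub>Q q \<in> ?U" using subspace_rscale[OF subspace_span] by blast
  qed
  moreover have "S \<subseteq> ?U"
  proof
    fix x assume "x \<in> S"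
    then show "x \<in> ?U" by (intro CollectI exI[of _ "{x}"]) (simp add: span_base)
  qed
  ultimately show ?thesis using span_minimal[of S ?U] assms by blast
qed

section \<open>Bases extracted from a well-order\<close>

definition echelon :: "('v \<times> 'v) set \<Rightarrow> 'v set" where
  "echelon R = {x. x \<notin> span {y. (y, x) \<in> R}}"

text \<open>In a nontrivial relation, the \<open>R\<close>-greatest vector with a nonzero
  coefficient would be a combination of its predecessors.\<close>

lemma echelon_independent:
  assumes R: "wf R" "trans R" "total R"
    and F: "finite F" "F \<subseteq> echelon R"
    and zero: "(\<Sum>x\<in>F. x *\<^sub>Q c x) = 0" and "x \<in> F"
  shows "c x = 0"
proof (rule ccontr)
  assume "c x \<noteq> 0"
  let ?G = "{x \<in> F. c x \<noteq> 0}"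
  let ?lt = "\<lambda>x y. (x, y) \<in> R"
  have "\<exists>m\<in>?G. \<forall>y\<in>?G. y \<noteq> m \<longrightarrow> \<not> ?lt m y"
  proof (rule Finite_Set.bex_max_element)
    show "asymp_on ?G ?lt" using wf_asym[OF R(1)] by (auto intro: asymp_onI)
    show "transp_on ?G ?lt" using R(2) by (auto intro!: transp_onI dest: transD)
  qed (use F \<open>x \<in> F\<close> \<open>c x \<noteq> 0\<close> in auto)
  \<comment> \<open>Since \<open>R\<close> is total, a maximal vector of the support
    \<open>?G\<close> is its greatest one.\<close>
  then obtain m where m: "m \<in> F" "c m \<noteq> 0"
    and max: "\<And>y. y \<in> F \<Longrightarrow> c y \<noteq> 0 \<Longrightarrow> y \<noteq> m \<Longrightarrow> (y, m) \<in> R"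
    using R(3) unfolding total_on_def by blast
  let ?S = "span {y. (y, m) \<in> R}"
  have "(\<Sum>y\<in>F - {m}. y *\<^sub>Q c y) \<in> ?S"
  proof (rule subspace_sum[OF subspace_span])
    fix y assume "y \<in> F - {m}"
    then show "y *\<^sub>Q c y \<in> ?S"
      using max[of y] subspace_rscale[OF subspace_span span_base, of y]
      by (cases "c y = 0") (auto intro: subspace_0[OF subspace_span])
  qed
  moreover have "m *\<^sub>Q c m = 0 - (\<Sum>y\<in>F - {m}. y *\<^sub>Q c y)"
    using zero m F(1) by (simp add: sum.remove[of F m] eq_neg_iff_add_eq_0)
  ultimately have "m *\<^sub>Q c m \<in> ?S"
    using subspace_diff[OF subspace_span] subspace_0[OF subspace_span] by metis
  \<comment> \<open>Scalars act on the right, so the coefficient is cancelled by its inverse on the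
    right.\<close>
  then have "(m *\<^sub>Q c m) *\<^sub>Q inverse (c m) \<in> ?S" by (rule subspace_rscale[OF subspace_span])
  then have "m \<in> ?S" using m by (simp add: rscale_rscale rscale_one)
  then show False using m F by (auto simp: echelon_def)
qed

text \<open>Induction along \<open>R\<close>: a vector that is not kept is a combination of
  predecessors whose \<open>r\<close> is no larger, and these are already treated. The assumption
  \<open>step\<close> is the compatibility between the order and \<open>r\<close>; it is checked
  below for both filtrations.\<close>

lemma span_echelon:
  fixes r :: "'v \<Rightarrow> nat"
  assumes "wf R"
    and step: "\<And>x. x \<in> span {y. (y, x) \<in> R} \<Longrightarrow> x \<in> span {y. (y, x) \<in> R \<and> r y \<le> r x}"
  shows "x \<in> span {y \<in> echelon R. r y \<le> r x}"
  using \<open>wf R\<close>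
proof (induction x)
  case (less x)
  show ?case
  proof (cases "x \<in> echelon R")
    case True
    then show ?thesis by (auto intro: span_base)
  next
    case False
    then have "x \<in> span {y. (y, x) \<in> R \<and> r y \<le> r x}" by (auto simp: echelon_def intro: step)
    also have "\<dots> \<subseteq> span {y \<in> echelon R. r y \<le> r x}"
    proof (intro span_minimal subspace_span subsetI)
      fix y assume y: "y \<in> {y. (y, x) \<in> R \<and> r y \<le> r x}"
      then have "y \<in> span {z \<in> echelon R. r z \<le> r y}" using less by blast
      also have "\<dots> \<subseteq> span {z \<in> echelon R. r z \<le> r x}" using y by (intro span_mono) auto
      finally show "y \<in> span {y \<in> echelon R. r y \<le> r x}" .
    qed
    finally show ?thesis .
  qed
qed

text \<open>Each vector of a finite spanning family involves finitely many kept vectors, so a finite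
  set of kept vectors spans. A further kept vector would depend on that set, against
  independence.\<close>

lemma echelon_finite:
  assumes "finite_dim" and R: "wf R" "trans R" "total R" and span: "span (echelon R) = UNIV"
  shows "finite (echelon R)"
proof -
  obtain n e where e: "spanning_family n e"
    using assms(1) by (auto simp: finite_dim_def ordered_basis_def)
  have "\<forall>i. \<exists>T. finite T \<and> T \<subseteq> echelon R \<and> e i \<in> span T"
    using span span_finite_subset by blast
  then obtain T where T: "\<And>i. finite (T i)" "\<And>i. T i \<subseteq> echelon R" "\<And>i. e i \<in> span (T i)"
    by metis
  let ?T = "\<Union>i<n. T i"
  have spT: "x \<in> span ?T" for x
  proof -
    obtain c where "x = (\<Sum>i<n. e i *\<^sub>Q c i)" using e by (auto simp: spanning_family_def)
    moreover have "e i \<in> span ?T" if "i < n" for i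
      using T(3)[of i] span_mono[of "T i" ?T] that by blast
    ultimately show ?thesis
      by (auto intro!: subspace_sum subspace_rscale subspace_span)
  qed
  have "echelon R \<subseteq> ?T"
  proof (rule subsetI, rule ccontr)
    fix x assume x: "x \<in> echelon R" "x \<notin> ?T"
    obtain c where c: "x = (\<Sum>y\<in>?T. y *\<^sub>Q c y)"
      using span_image_finite[of ?T x id] spT[of x] T(1) by auto
    \<comment> \<open>The value -1 at \<open>x\<close> turns the expression of \<open>x\<close> over
      \<open>?T\<close> into a relation over \<open>insert x ?T\<close>.\<close>
    let ?c = "c(x := - 1)"
    have "(\<Sum>y\<in>?T. y *\<^sub>Q ?c y) = (\<Sum>y\<in>?T. y *\<^sub>Q c y)"
      by (rule sum.cong) (use x in auto)
    then have "(\<Sum>y\<in>insert x ?T. y *\<^sub>Q ?c y) = 0"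
      using x T(1) c by (simp add: rscale_minus_right rscale_one)
    then have "?c x = 0"
      using T x by (intro echelon_independent[OF R, of "insert x ?T"]) auto
    then show False by simp
  qed
  then show ?thesis using T(1) by (meson finite_UN finite_lessThan finite_subset)
qed

text \<open>The bijection stays in the conclusion so that span statements about
  \<open>echelon R\<close> carry over to the image of \<open>e\<close>.\<close>

lemma echelon_ordered_basis:
  assumes "finite_dim" and R: "wf R" "trans R" "total R" and span: "span (echelon R) = UNIV"
  shows "\<exists>n e. ordered_basis n e \<and> bij_betw e {..<n} (echelon R)"
proof -
  let ?E = "echelon R"
  have fin: "finite ?E" using assms by (rule echelon_finite)
  then obtain e where e: "bij_betw e {..<card ?E} ?E"
    using ex_bij_betw_nat_finite[of ?E] by (auto simp: atLeast0LessThan)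
  let ?n = "card ?E"
  have "independent_family ?n e"
    unfolding independent_family_def
  proof (intro allI impI)
    fix c i assume zero: "(\<Sum>i<?n. e i *\<^sub>Q c i) = 0" and "i < ?n"
    \<comment> \<open>Independence of a family has coefficients indexed by numbers,
      \<open>echelon_independent\<close> has them indexed by vectors; \<open>?g\<close>
      translates.\<close>
    let ?g = "the_inv_into {..<?n} e"
    have g: "?g (e i) = i" if "i < ?n" for i
      using that e by (intro the_inv_into_f_f) (auto simp: bij_betw_def)
    have "(\<Sum>x\<in>?E. x *\<^sub>Q c (?g x)) = (\<Sum>i<?n. e i *\<^sub>Q c (?g (e i)))"
      by (rule sum.reindex_bij_betw[OF e, symmetric])
    also have "\<dots> = 0" using zero g by simp
    finally have "c (?g (e i)) = 0"
      using e \<open>i < ?n\<close> by (intro echelon_independent[OF R fin]) (auto simp: bij_betw_def)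
    then show "c i = 0" using g \<open>i < ?n\<close> by simp
  qed
  moreover have "spanning_family ?n e"
    unfolding spanning_family_def
    using span_image_finite[of "{..<?n}" _ e] e span by (auto simp: bij_betw_def)
  ultimately show ?thesis using e by (auto simp: ordered_basis_def)
qed

section \<open>Filtrations, encoded by the first stage containing a vector, and bases adapted to two
  of them\<close>

definition filtration :: "('v \<Rightarrow> nat) \<Rightarrow> bool" where
  "filtration r \<longleftrightarrow> (\<forall>i. subspace {x. r x \<le> i})"

text \<open>The last two conjuncts express adaptedness: every stage of either filtration is spanned
  by the basis vectors in it. Since the order compares \<open>k\<close> first, only \<open>l\<close>
  requires an argument.\<close>

lemma filtrations_ordered_basis:
  assumes "finite_dim" and k: "filtration k" and l: "filtration l"
  shows "\<exists>n e. ordered_basis n e \<and> inj_on e {..<n} \<and> 0 \<notin> e ` {..<n}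
    \<and> (\<forall>x. x \<in> span {y \<in> e ` {..<n}. k y \<le> k x})
    \<and> (\<forall>x. x \<in> span {y \<in> e ` {..<n}. l y \<le> l x})"
proof -
  obtain r :: "('v \<times> 'v) set" where r: "well_order_on UNIV r"
    using well_order_on by blast
  let ?Q = "less_than <*lex*> less_than <*lex*> (r - Id)"
  let ?f = "\<lambda>x. (k x, l x, x)"
  define R where "R = inv_image ?Q ?f"
  have R_iff: "(y, x) \<in> R \<longleftrightarrow> k y < k x \<or> k y = k x \<and> (l y < l x \<or> l y = l x \<and> (y, x) \<in> r - Id)" for x y
    by (auto simp: R_def)
  have rr: "wf (r - Id)" "trans r" "antisym r" "total r"
    using r by (auto simp: well_order_on_def linear_order_on_def partial_order_on_def preorder_on_def)
  have wf: "wf R"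
    unfolding R_def using rr by (intro wf_inv_image wf_lex_prod wf_less_than)
  have trans: "trans R"
    unfolding R_def using rr by (intro trans_inv_image trans_lex_prod trans_less_than trans_diff_Id)
  have total: "total R"
    unfolding total_on_def R_iff using rr(4) by (auto simp: total_on_def)
  have spk: "x \<in> span {y \<in> echelon R. k y \<le> k x}" for x
  proof (rule span_echelon[OF wf])
    fix x assume "x \<in> span {y. (y, x) \<in> R}"
    \<comment> \<open>A predecessor never has a larger \<open>k\<close>.\<close>
    moreover have "{y. (y, x) \<in> R} = {y. (y, x) \<in> R \<and> k y \<le> k x}" by (auto simp: R_iff)
    ultimately show "x \<in> span {y. (y, x) \<in> R \<and> k y \<le> k x}" by metis
  qed
  have spl: "x \<in> span {y \<in> echelon R. l y \<le> l x}" for x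
  proof (rule span_echelon[OF wf])
    fix x
    \<comment> \<open>A predecessor with smaller \<open>k\<close> may have a larger
      \<open>l\<close>; one with equal \<open>k\<close> may not. Hence \<open>?A\<close> and
      \<open>?B\<close> together cover all predecessors.\<close>
    let ?A = "{y. k y < k x}" and ?B = "{y. (y, x) \<in> R \<and> l y \<le> l x}"
    assume "x \<in> span {y. (y, x) \<in> R}"
    also have "\<dots> \<subseteq> span (?A \<union> ?B)" by (intro span_mono) (auto simp: R_iff)
    finally obtain w z where w: "w \<in> span ?A" and z: "z \<in> span ?B" and x: "x = w + z"
      using span_Un by blast
    txt \<open>From \<open>w = x - z\<close> and \<open>l z \<le> l x\<close> we get \<open>l w \<le> l x\<close>, so \<open>w\<close> itself lies in \<open>?B\<close> (or is \<open>0\<close>).\<close>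
    have "w \<in> span ?B"
    proof (cases "k x")
      case 0
      \<comment> \<open>Here \<open>?A\<close> is empty, so \<open>w\<close> is 0.\<close>
      then show ?thesis using w subspace_0[OF subspace_span] by (simp add: span_empty)
    next
      case (Suc i)
      \<comment> \<open>Now \<open>?A\<close> is stage \<open>i\<close> of \<open>k\<close>, hence a
        subspace containing \<open>w\<close>. So \<open>k w < k x\<close>, which makes
        \<open>w\<close> a predecessor of \<open>x\<close>; what remains for \<open>?B\<close> is
        the bound on \<open>l w\<close>.\<close>
      have "span ?A \<subseteq> ?A"
        using k Suc by (intro span_minimal) (auto simp: filtration_def less_Suc_eq_le)
      moreover have sub: "subspace {y. l y \<le> l x}" using l by (simp add: filtration_def)
      then have "z \<in> {y. l y \<le> l x}" using span_minimal[of ?B "{y. l y \<le> l x}"] z by blast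
      then have "x - z \<in> {y. l y \<le> l x}" by (intro subspace_diff sub) auto
      then have "l w \<le> l x" using x by simp
      ultimately show ?thesis using w by (intro span_base) (auto simp: R_iff)
    qed
    then show "x \<in> span ?B"
      using x z subspace_add[OF subspace_span] by metis
  qed
  have "{y \<in> echelon R. k y \<le> k x} \<subseteq> echelon R" for x by blast
  then have "span (echelon R) = UNIV" using spk span_mono by blast
  then obtain n e where e: "ordered_basis n e" "bij_betw e {..<n} (echelon R)"
    using echelon_ordered_basis assms(1) wf trans total by blast
  moreover have "0 \<notin> echelon R" using subspace_0[OF subspace_span] by (auto simp: echelon_def)
  ultimately show ?thesis
    using spk spl by (intro exI[of _ n] exI[of _ e]) (simp add: bij_betw_def)
qed

section \<open>Endomorphisms, and the kernel filtration of a nilpotent one\<close>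

lemma endomorphism_add: "endomorphism f \<Longrightarrow> f (x + y) = f x + f y"
  and endomorphism_rscale: "endomorphism f \<Longrightarrow> f (x *\<^sub>Q q) = f x *\<^sub>Q q"
  by (auto simp: endomorphism_def)

lemma endomorphism_0: "endomorphism f \<Longrightarrow> f 0 = 0"
  using endomorphism_rscale[of f 0 0] by simp

lemma endomorphism_sum: "endomorphism f \<Longrightarrow> f (sum g A) = (\<Sum>i\<in>A. f (g i))"
  by (induction A rule: infinite_finite_induct) (auto simp: endomorphism_0 endomorphism_add)

lemma endomorphism_funpow: "endomorphism f \<Longrightarrow> endomorphism (f ^^ k)"
  by (induction k) (auto simp: endomorphism_def)

text \<open>Stage \<open>i\<close> is the kernel of \<open>f ^^ i\<close>, so the rank of
  \<open>x\<close> is the least exponent that kills it. As \<open>f\<close> maps each kernel into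
  the preceding one, it lowers the rank of nonzero vectors.\<close>

lemma nilpotent_filtration:
  assumes "nilpotent_endomorphism f"
  shows "\<exists>r. filtration r \<and> (\<forall>x. x \<noteq> 0 \<longrightarrow> r (f x) < r x)"
proof -
  obtain N where f: "endomorphism f" and N: "f ^^ N = (\<lambda>_. 0)"
    using assms by (auto simp: nilpotent_endomorphism_def)
  let ?r = "\<lambda>x. LEAST i. (f ^^ i) x = 0"
  have mono: "(f ^^ j) x = 0" if "(f ^^ i) x = 0" "i \<le> j" for i j x
  proof -
    have "(f ^^ j) x = (f ^^ (j - i)) ((f ^^ i) x)"
      using that(2) funpow_add[of "j - i" i f] by simp
    then show ?thesis using that(1) endomorphism_0[OF endomorphism_funpow[OF f]] by simp
  qed
  have r: "(f ^^ ?r x) x = 0" for x using LeastI[of "\<lambda>i. (f ^^ i) x = 0" N] N by simp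
  have r_le: "?r x \<le> i \<longleftrightarrow> (f ^^ i) x = 0" for x i
    using mono[OF r] by (auto intro: Least_le)
  have "filtration ?r"
    unfolding filtration_def r_le subspace_def
    using endomorphism_funpow[OF f] by (simp add: endomorphism_0 endomorphism_add endomorphism_rscale)
  moreover have "?r (f x) < ?r x" if "x \<noteq> 0" for x
  proof -
    \<comment> \<open>The power with exponent 0 is the identity, so only the zero vector has rank
      0.\<close>
    have "?r x \<noteq> 0" using r_le[of x 0] that by auto
    then obtain i where i: "?r x = Suc i" by (cases "?r x") auto
    then have "(f ^^ i) (f x) = 0" using r[of x] by (simp add: funpow_swap1)
    then show ?thesis using i r_le[of "f x" i] by simp
  qed
  ultimately show ?thesis by (intro exI[of _ ?r]) blast
qed

section \<open>From two nilpotent summands to a zero diagonal\<close>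

lemma sum_nilpotent_imp_zero_diagonal:
  assumes "finite_dim" and a: "nilpotent_endomorphism a" and b: "nilpotent_endomorphism b"
  shows "\<exists>n e m. ordered_basis n e \<and> has_matrix n e (\<lambda>x. a x + b x) m \<and> (\<forall>i<n. m i i = 0)"
proof -
  obtain k where k: "filtration k" "\<And>x. x \<noteq> 0 \<Longrightarrow> k (a x) < k x"
    using nilpotent_filtration[OF a] by blast
  obtain l where l: "filtration l" "\<And>x. x \<noteq> 0 \<Longrightarrow> l (b x) < l x"
    using nilpotent_filtration[OF b] by blast
  obtain n e where e: "ordered_basis n e" "inj_on e {..<n}" "0 \<notin> e ` {..<n}"
    and spk: "\<And>x. x \<in> span {y \<in> e ` {..<n}. k y \<le> k x}"
    and spl: "\<And>x. x \<in> span {y \<in> e ` {..<n}. l y \<le> l x}"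
    using filtrations_ordered_basis[OF assms(1) k(1) l(1)] by blast
  have "\<exists>c. a (e j) + b (e j) = (\<Sum>i<n. e i *\<^sub>Q c i) \<and> c j = 0" if j: "j < n" for j
  proof -
    let ?I = "{..<n} - {j}"
    have nz: "e j \<noteq> 0" using e(3) j by force
    \<comment> \<open>The rank of \<open>a (e j)\<close> is strictly below that of
      \<open>e j\<close>, so \<open>e j\<close> is not among the basis vectors that span its
      stage.\<close>
    have "{y \<in> e ` {..<n}. k y \<le> k (a (e j))} \<subseteq> e ` ?I" using k(2)[OF nz] by auto
    then have "a (e j) \<in> span (e ` ?I)" using spk span_mono by blast
    moreover have "{y \<in> e ` {..<n}. l y \<le> l (b (e j))} \<subseteq> e ` ?I" using l(2)[OF nz] by auto
    then have "b (e j) \<in> span (e ` ?I)" using spl span_mono by blast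
    ultimately have "a (e j) + b (e j) \<in> span (e ` ?I)"
      by (rule subspace_add[OF subspace_span])
    then obtain c where c: "a (e j) + b (e j) = (\<Sum>i\<in>?I. e i *\<^sub>Q c i)"
      using span_image_finite[of ?I] by blast
    \<comment> \<open>Padding with coefficient 0 at \<open>j\<close> yields a full coordinate
      vector, whose entry at \<open>j\<close> is the diagonal entry.\<close>
    have "(\<Sum>i<n. e i *\<^sub>Q (c(j := 0)) i) = (\<Sum>i\<in>?I. e i *\<^sub>Q c i)"
      using j by (simp add: sum.remove[of "{..<n}" j])
    then show ?thesis using c by (intro exI[of _ "c(j := 0)"]) simp
  qed
  then obtain c where c: "\<And>j. j < n \<Longrightarrow> a (e j) + b (e j) = (\<Sum>i<n. e i *\<^sub>Q c j i) \<and> c j j = 0"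
    by metis
  then show ?thesis
    \<comment> \<open>Each \<open>c j\<close> is the column of index \<open>j\<close>, hence the
      exchanged arguments.\<close>
    using e(1) by (intro exI[of _ n] exI[of _ e] exI[of _ "\<lambda>i j. c j i"]) (auto simp: has_matrix_def)
qed

section \<open>Endomorphisms defined by matrices, and from a zero diagonal to nilpotent
  summands\<close>

lemma endomorphism_on_basis:
  assumes "ordered_basis n e"
  shows "\<exists>f. endomorphism f \<and> (\<forall>c. f (\<Sum>j<n. e j *\<^sub>Q c j) = (\<Sum>j<n. g j *\<^sub>Q c j))"
proof -
  have "\<forall>x. \<exists>c. x = (\<Sum>j<n. e j *\<^sub>Q c j)"
    using assms by (simp add: ordered_basis_def spanning_family_def)
  \<comment> \<open>\<open>C\<close> chooses coordinates; their uniqueness, shown next, makes the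
    linear extension independent of the expression of a vector.\<close>
  then obtain C where C: "\<And>x. x = (\<Sum>j<n. e j *\<^sub>Q C x j)" by metis
  have uniq: "c j = d j" if "(\<Sum>j<n. e j *\<^sub>Q c j) = (\<Sum>j<n. e j *\<^sub>Q d j)" "j < n" for c d j
  proof -
    have indep: "independent_family n e" using assms by (simp add: ordered_basis_def)
    have "(\<Sum>j<n. e j *\<^sub>Q (c j - d j)) = 0"
      using that(1) by (simp add: rscale_diff_right sum_subtractf)
    then have "\<forall>j<n. c j - d j = 0"
      using indep[unfolded independent_family_def, THEN spec[of _ "\<lambda>j. c j - d j"]] by blast
    then show ?thesis using that(2) by simp
  qed
  let ?f = "\<lambda>x. \<Sum>j<n. g j *\<^sub>Q C x j"
  have f: "?f (\<Sum>j<n. e j *\<^sub>Q c j) = (\<Sum>j<n. g j *\<^sub>Q c j)" for c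
    using uniq[OF C[symmetric]] by (intro sum.cong) auto
  have "?f (x + y) = ?f x + ?f y" for x y
  proof -
    have "x + y = (\<Sum>j<n. e j *\<^sub>Q (C x j + C y j))"
      using C[of x] C[of y] by (simp add: rscale_add_right sum.distrib)
    then have "?f (x + y) = (\<Sum>j<n. g j *\<^sub>Q (C x j + C y j))" by (simp only: f)
    then show ?thesis by (simp add: rscale_add_right sum.distrib)
  qed
  moreover have "?f (x *\<^sub>Q q) = ?f x *\<^sub>Q q" for x q
  proof -
    have "x *\<^sub>Q q = (\<Sum>j<n. e j *\<^sub>Q (C x j * q))"
      using arg_cong[OF C[of x], of "\<lambda>z. z *\<^sub>Q q"] by (simp add: rscale_sum_left rscale_rscale)
    then have "?f (x *\<^sub>Q q) = (\<Sum>j<n. g j *\<^sub>Q (C x j * q))" by (simp only: f)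
    then show ?thesis by (simp add: rscale_sum_left rscale_rscale)
  qed
  ultimately have "endomorphism ?f" by (simp add: endomorphism_def)
  then show ?thesis using f by blast
qed

lemma endomorphism_matrix:
  assumes "endomorphism f" "has_matrix n e f m"
  shows "f (\<Sum>j<n. e j *\<^sub>Q c j) = (\<Sum>i<n. e i *\<^sub>Q (\<Sum>j<n. m i j * c j))"
proof -
  have "f (\<Sum>j<n. e j *\<^sub>Q c j) = (\<Sum>j<n. \<Sum>i<n. e i *\<^sub>Q (m i j * c j))"
    using assms by (simp add: endomorphism_sum endomorphism_rscale has_matrix_def
        rscale_sum_left rscale_rscale)
  also have "\<dots> = (\<Sum>i<n. e i *\<^sub>Q (\<Sum>j<n. m i j * c j))"
    by (subst sum.swap) (simp add: rscale_sum_right)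
  finally show ?thesis .
qed

lemma endomorphism_of_matrix:
  assumes "ordered_basis n e"
  shows "\<exists>f. endomorphism f \<and> has_matrix n e f m"
proof -
  obtain f where f: "endomorphism f"
    "\<And>c. f (\<Sum>j<n. e j *\<^sub>Q c j) = (\<Sum>j<n. (\<Sum>i<n. e i *\<^sub>Q m i j) *\<^sub>Q c j)"
    using endomorphism_on_basis[OF assms, of "\<lambda>j. \<Sum>i<n. e i *\<^sub>Q m i j"] by blast
  have unit: "(\<Sum>j<n. g j *\<^sub>Q (if j = i then 1 else 0)) = g i" if "i < n" for i and g :: "nat \<Rightarrow> 'v"
    using that by (subst sum.remove[of _ i]) (auto simp: rscale_one intro!: sum.neutral)
  have "f (e i) = (\<Sum>j<n. e j *\<^sub>Q m j i)" if "i < n" for i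
    using f(2)[of "\<lambda>j. if j = i then 1 else 0"] unit[OF that] by simp
  then show ?thesis using f(1) by (auto simp: has_matrix_def)
qed

text \<open>Think of \<open>r\<close> as a weight on indices: \<open>f\<close> sends a basis vector
  to a combination of basis vectors of smaller weight, and weights are bounded by \<open>N\<close>.
  A general weight treats upper and lower triangular matrices alike.\<close>

lemma nilpotent_of_triangular:
  fixes r :: "nat \<Rightarrow> nat"
  assumes e: "ordered_basis n e" and f: "endomorphism f" "has_matrix n e f m"
    and r: "\<And>i. i < n \<Longrightarrow> r i \<le> N" "\<And>i j. i < n \<Longrightarrow> j < n \<Longrightarrow> m i j \<noteq> 0 \<Longrightarrow> r i < r j"
  shows "nilpotent_endomorphism f"
proof -
  \<comment> \<open>Invariant: every index in the support of the coordinates has lost at least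
    \<open>k\<close> from the maximal weight \<open>N\<close>.\<close>
  have step: "\<exists>c. (f ^^ k) x = (\<Sum>i<n. e i *\<^sub>Q c i) \<and> (\<forall>i<n. c i \<noteq> 0 \<longrightarrow> r i + k \<le> N)" for k x
  proof (induction k)
    case 0
    then show ?case
      using e r(1) by (simp add: ordered_basis_def spanning_family_def)
  next
    case (Suc k)
    then obtain c where c: "(f ^^ k) x = (\<Sum>i<n. e i *\<^sub>Q c i)" "\<forall>i<n. c i \<noteq> 0 \<longrightarrow> r i + k \<le> N"
      by blast
    have "r i + Suc k \<le> N" if "i < n" and nz: "(\<Sum>j<n. m i j * c j) \<noteq> 0" for i
    proof -
      obtain j where "j < n" "m i j * c j \<noteq> 0" using nz by (auto elim: sum.not_neutral_contains_not_neutral)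
      then have "r i < r j" "r j + k \<le> N" using r(2)[of i j] c(2) that(1) by auto
      then show ?thesis by simp
    qed
    then show ?case
      using c(1) endomorphism_matrix[OF f] by (intro exI[of _ "\<lambda>i. \<Sum>j<n. m i j * c j"]) simp
  qed
  \<comment> \<open>The exponent is \<open>Suc N\<close> because the invariant still permits an
    index of weight 0 after \<open>N\<close> applications.\<close>
  have "(f ^^ Suc N) x = 0" for x
  proof -
    obtain c where "(f ^^ Suc N) x = (\<Sum>i<n. e i *\<^sub>Q c i)" "\<forall>i<n. c i \<noteq> 0 \<longrightarrow> r i + Suc N \<le> N"
      using step by blast
    then show ?thesis by (auto intro!: sum.neutral)
  qed
  then show ?thesis using f(1) unfolding nilpotent_endomorphism_def by blast
qed

lemma zero_diagonal_imp_sum_nilpotent: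
  assumes e: "ordered_basis n e" and u: "endomorphism u" "has_matrix n e u m"
    and diag: "\<And>i. i < n \<Longrightarrow> m i i = 0"
  shows "\<exists>a b. nilpotent_endomorphism a \<and> nilpotent_endomorphism b \<and> u = (\<lambda>x. a x + b x)"
proof -
  let ?A = "\<lambda>i j. if i < j then m i j else 0" and ?B = "\<lambda>i j. if j < i then m i j else 0"
  obtain a where a: "endomorphism a" "has_matrix n e a ?A"
    using endomorphism_of_matrix[OF e] by blast
  obtain b where b: "endomorphism b" "has_matrix n e b ?B"
    using endomorphism_of_matrix[OF e] by blast
  have "nilpotent_endomorphism a"
    by (rule nilpotent_of_triangular[OF e a, where r = "\<lambda>i. i" and N = n]) (auto split: if_splits)
  moreover have "nilpotent_endomorphism b"
    \<comment> \<open>The reversed weight \<open>n - i\<close> makes the strictly lower triangular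
      entries weight-decreasing; truncated subtraction is harmless since indices are below
      \<open>n\<close>.\<close>
    by (rule nilpotent_of_triangular[OF e b, where r = "\<lambda>i. n - i" and N = n]) (auto split: if_splits)
  moreover have "u x = a x + b x" for x
  proof -
    obtain c where x: "x = (\<Sum>j<n. e j *\<^sub>Q c j)"
      using e by (auto simp: ordered_basis_def spanning_family_def)
    \<comment> \<open>The vanishing diagonal is exactly what the two strict triangles leave
      uncovered.\<close>
    have m: "m i j = ?A i j + ?B i j" if "i < n" for i j
      using diag[OF that] by (cases i j rule: linorder_cases) auto
    have "(\<Sum>j<n. m i j * c j) = (\<Sum>j<n. ?A i j * c j) + (\<Sum>j<n. ?B i j * c j)" if "i < n" for i
      by (subst m[OF that]) (simp only: distrib_right sum.distrib)
    then show ?thesis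
      unfolding x endomorphism_matrix[OF u] endomorphism_matrix[OF a] endomorphism_matrix[OF b]
      by (simp add: rscale_add_right sum.distrib)
  qed
  ultimately show ?thesis by blast
qed

end

theorem corollary1p6:
  fixes scale :: "'f::field \<Rightarrow> 'q::division_ring \<Rightarrow> 'q"
    and rscale :: "'v::ab_group_add \<Rightarrow> 'q \<Rightarrow> 'v"
    and u :: "'v \<Rightarrow> 'v"
  assumes "quaternion_division_algebra scale"
    and "right_vector_space rscale"
    and "right_vector_space.finite_dim rscale"
    and "right_vector_space.endomorphism rscale u"
  shows "(\<exists>n e m. right_vector_space.ordered_basis rscale n e
              \<and> right_vector_space.has_matrix rscale n e u m
              \<and> (\<forall>i<n. m i i = 0))
     \<longleftrightarrow> (\<exists>a b. right_vector_space.nilpotent_endomorphism rscale a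
              \<and> right_vector_space.nilpotent_endomorphism rscale b
              \<and> u = (\<lambda>x. a x + b x))"
proof -
  interpret right_vector_space rscale by (rule assms(2))
  show ?thesis
    using zero_diagonal_imp_sum_nilpotent[OF _ assms(4)]
      sum_nilpotent_imp_zero_diagonal[OF assms(3)] by blast
qed

end
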